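(* Let $n\ge 0$, $k\in\mathbb{Z}$ and $a\in\mathbb{C}$ with $a\neq0$. Then \[ PC_{n}^{(k)}(x:a)=a^{-n}\sum_{j=0}^{n}\left\{\sum_{m=j}^{n}\sum_{l=0}^{n-m}(-1)^{l+j}\binom{n}{l}\binom{m}{j}\frac{a^{l}}{(m-j+1)^{k}}\,S_{1}(n-l,m)\right\}x^{j}. \]
   Context: For an integer $k$, $\mathrm{Lif}_k(t)=\sum_{n=0}^{\infty}\frac{t^{n}}{n!\,(n+1)^{k}}$. For $a\neq0$, $PC_n^{(k)}(x:a)$ is defined by $e^{-t}\,\mathrm{Lif}_k\!\left(\log\left(1+\frac{t}{a}\right)\right)\left(1+\frac{t}{a}\right)^{-x}=\sum_{n\ge0}PC_n^{(k)}(x:a)\frac{t^n}{n!}$. $S_1(n,l)$ denotes the (signed) Stirling numbers of the first kind, defined by $x(x-1)\cdots(x-n+1)=\sum_{l=0}^{n}S_1(n,l)x^l$. *)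

theory Defs
  imports Complex_Main
    "HOL-Computational_Algebra.Polynomial"
    "HOL-Computational_Algebra.Formal_Power_Series"
begin

unbundle fps_syntax

definition Lif :: "int \<Rightarrow> complex fps" where
  "Lif k = Abs_fps (\<lambda>n. 1 / (fact n * of_nat (n + 1) powi k))"

text \<open>
  The library's \<^term>\<open>fps_ln 1\<close> and \<^term>\<open>fps_binomial c\<close> are the expansions of
  \<open>log (1 + t)\<close> and \<open>(1 + t)\<^sup>c\<close>; composition with \<open>t / a\<close> replaces \<open>1 + t\<close> by \<open>1 + t / a\<close>.
\<close>

definition PC_gf :: "int \<Rightarrow> complex \<Rightarrow> complex \<Rightarrow> complex fps" where
  "PC_gf k x a =
     fps_exp (- 1)
     * (Lif k oo (fps_ln 1 oo (fps_const (1 / a) * fps_X)))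
     * (fps_binomial (- x) oo (fps_const (1 / a) * fps_X))"

definition PC :: "nat \<Rightarrow> int \<Rightarrow> complex \<Rightarrow> complex \<Rightarrow> complex" where
  "PC n k x a = fact n * PC_gf k x a $ n"

lemma PC_gf_eq: "PC_gf k x a = Abs_fps (\<lambda>n. PC n k x a / fact n)"
  by (rule fps_ext) (simp add: PC_def)

definition S1 :: "nat \<Rightarrow> nat \<Rightarrow> int" where
  "S1 n l = coeff (\<Prod>i<n. [:- int i, 1:]) l"

lemma S1_0: "S1 0 l = (if l = 0 then 1 else 0)"
  by (simp add: S1_def)

lemma S1_Suc_0: "S1 (Suc n) 0 = - int n * S1 n 0"
  by (simp add: S1_def)

lemma S1_Suc_Suc: "S1 (Suc n) (Suc l) = S1 n l - int n * S1 n (Suc l)"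
  by (simp add: S1_def)

lemma S1_eq_0: "n < l \<Longrightarrow> S1 n l = 0"
proof (induction n arbitrary: l)
  case 0
  then show ?case by (simp add: S1_0)
next
  case (Suc n)
  then show ?case by (cases l) (simp_all add: S1_Suc_Suc)
qed

lemma falling_factorial_eq_sum_S1:
  fixes x :: "'a :: comm_ring_1"
  shows "(\<Prod>i<n. x - of_nat i) = (\<Sum>l\<le>n. of_int (S1 n l) * x ^ l)"
proof (induction n)
  case 0
  then show ?case by (simp add: S1_0)
next
  case (Suc n)
  have tail: "(\<Sum>l\<le>n. of_int (S1 n l) * x ^ l)
      = of_int (S1 n 0) + (\<Sum>l\<le>n. of_int (S1 n (Suc l)) * x ^ Suc l)"
    using sum.atMost_Suc_shift[of "\<lambda>l. of_int (S1 n l) * x ^ l" n]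
    by (simp add: S1_eq_0)
  have "(\<Sum>l\<le>Suc n. of_int (S1 (Suc n) l) * x ^ l)
      = of_int (S1 (Suc n) 0) + (\<Sum>l\<le>n. of_int (S1 (Suc n) (Suc l)) * x ^ Suc l)"
    by (subst sum.atMost_Suc_shift) simp
  also have "\<dots> = x * (\<Sum>l\<le>n. of_int (S1 n l) * x ^ l)
      - of_nat n * (of_int (S1 n 0) + (\<Sum>l\<le>n. of_int (S1 n (Suc l)) * x ^ Suc l))"
    by (simp add: S1_Suc_0 S1_Suc_Suc sum_distrib_left sum_subtractf algebra_simps)
  also have "\<dots> = (x - of_nat n) * (\<Sum>l\<le>n. of_int (S1 n l) * x ^ l)"
    by (simp only: tail [symmetric] left_diff_distrib)
  finally show ?case using Suc.IH by (simp add: mult.commute)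
qed

end

theory Submission
  imports Defs
begin

text \<open>
  Put \<open>L = log (1 + t)\<close>. Since \<open>(1 + t)\<^sup>-\<^sup>x = exp (- x L)\<close>, the product of the last two factors of
  the generating function at \<open>a = 1\<close> is a single power series evaluated at \<open>L\<close>, and the
  coefficients of the powers of \<open>L\<close> are Stirling numbers. Replacing \<open>t\<close> by \<open>t / a\<close> and multiplying
  by \<open>e\<^sup>-\<^sup>t\<close> are then a rescaling and a Cauchy product.
\<close>

text \<open>Compare coefficients of t^N in (1 + t) (L^(m+1))' = (m+1) L^m. Up to the scaling m!/N!
  this is the recurrence \<open>S1_Suc_Suc\<close>.\<close>

lemma fps_ln_1_power_nth_Suc:
  "of_nat (Suc N) * ((fps_ln 1 :: 'a::field_char_0 fps) ^ Suc m $ Suc N)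
     = of_nat (Suc m) * (fps_ln 1 ^ m $ N) - of_nat N * (fps_ln 1 ^ Suc m $ N)"
proof -
  have "inverse (1 + fps_X) * (1 + fps_X :: 'a fps) = 1"
    by (rule inverse_mult_eq_1) simp
  then have "(1 + fps_X) * fps_deriv (fps_ln 1 ^ Suc m)
      = of_nat (Suc m) * (fps_ln 1 :: 'a fps) ^ m"
    by (simp add: fps_deriv_power fps_ln_deriv fps_of_nat mult_ac del: of_nat_Suc power_Suc)
  then have "((1 + fps_X) * fps_deriv ((fps_ln 1 :: 'a fps) ^ Suc m)) $ N
      = of_nat (Suc m) * (fps_ln 1 ^ m $ N)"
    by (simp add: fps_of_nat[symmetric] del: of_nat_Suc power_Suc)
  \<comment> \<open>For \<open>N = 0\<close> the part multiplied by \<open>fps_X\<close> contributes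
    nothing, in agreement with the factor \<open>of_nat N\<close>.\<close>
  then show ?thesis
    by (cases N) (simp_all add: distrib_right algebra_simps del: of_nat_Suc power_Suc)
qed

lemma fps_ln_1_power_nth:
  "(fps_ln 1 :: 'a::field_char_0 fps) ^ m $ N = fact m * of_int (S1 N m) / fact N"
proof (induction N arbitrary: m)
  case 0
  show ?case by (simp add: S1_0 fps_power_zeroth power_0_left)
next
  case (Suc N)
  show ?case
  proof (cases m)
    case 0
    \<comment> \<open>A nonempty falling factorial has the root 0; the base case vanishes through
      the factor \<open>int 0\<close> of the recurrence.\<close>
    have "S1 (Suc N) 0 = 0" by (induction N) (simp_all add: S1_Suc_0)
    with 0 show ?thesis by simp
  next
    case (Suc m')
    have "of_nat (Suc N) * ((fps_ln 1 :: 'a fps) ^ m $ Suc N)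
        = of_nat (Suc N) * (fact m * of_int (S1 (Suc N) m) / fact (Suc N))"
      unfolding Suc fps_ln_1_power_nth_Suc Suc.IH S1_Suc_Suc
      by (simp add: divide_simps del: of_nat_Suc) (simp add: algebra_simps)
    then show ?thesis by (simp only: mult_cancel_left of_nat_eq_0_iff nat.simps simp_thms)
  qed
qed

lemma fps_compose_fps_ln_1_nth:
  "((F :: 'a::field_char_0 fps) oo fps_ln 1) $ N
     = (\<Sum>m=0..N. F $ m * fact m * of_int (S1 N m)) / fact N"
  by (simp add: fps_compose_nth fps_ln_1_power_nth sum_divide_distrib mult.assoc)

text \<open>The N-th coefficients, times N!, are both the falling factorial of c: on the right the
  m! coming from L^m cancels the one in c^m/m!, leaving its Stirling expansion.\<close>

lemma fps_binomial_conv_exp_ln: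
  "fps_binomial (c :: 'a::field_char_0) = fps_exp c oo fps_ln 1"
proof (rule fps_ext)
  fix N
  have "fact N * (c gchoose N) = (\<Sum>l\<le>N. of_int (S1 N l) * c ^ l)"
    by (simp add: gbinomial_mult_fact falling_factorial_eq_sum_S1 [symmetric] atLeast0LessThan)
  then show "fps_binomial c $ N = (fps_exp c oo fps_ln 1) $ N"
    by (simp add: fps_compose_fps_ln_1_nth field_simps atLeast0AtMost)
qed

text \<open>The factor m! is the one that L^m brings; with 1/j! and 1/(m-j)! from the two series it
  forms the binomial coefficient.\<close>

lemma Lif_mult_exp_nth:
  "(Lif k * fps_exp (- x)) $ m * fact m
     = (\<Sum>j=0..m. (- 1) ^ j * of_nat (m choose j) * x ^ j / of_nat (m - j + 1) powi k)"
proof -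
  \<comment> \<open>With the exponential as first factor, the convolution index j is the exponent of
    x.\<close>
  have "(fps_exp (- x) * Lif k) $ m * fact m
     = (\<Sum>j=0..m. (- 1) ^ j * of_nat (m choose j) * x ^ j / of_nat (m - j + 1) powi k)"
    unfolding fps_mult_nth sum_distrib_right
    by (rule sum.cong)
      (auto simp: Lif_def binomial_fact power_minus[of x] mult_ac)
  then show ?thesis by (simp add: mult.commute)
qed

text \<open>Composition with a series without constant term is multiplicative, so both factors can
  share the inner series L.\<close>

lemma PC_gf_altdef:
  "PC_gf k x a
     = fps_exp (- 1) * (((Lif k * fps_exp (- x)) oo fps_ln 1) oo (fps_const (1 / a) * fps_X))"
  by (simp add: PC_gf_def fps_binomial_conv_exp_ln fps_compose_assoc fps_compose_mult_distrib
      mult.assoc)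

theorem theorem3:
  fixes n :: nat and k :: int and a x :: complex
  assumes "a \<noteq> 0"
  shows "PC n k x a =
    a powi (- int n) *
      (\<Sum>j = 0..n.
        (\<Sum>m = j..n. \<Sum>l = 0..n - m.
          (- 1) ^ (l + j) * of_nat (n choose l) * of_nat (m choose j)
            * (a ^ l / of_nat (m - j + 1) powi k) * of_int (S1 (n - l) m))
        * x ^ j)"
proof -
  define T where "T l m j = (- 1) ^ (l + j) * of_nat (n choose l) * of_nat (m choose j)
      * (a ^ l / of_nat (m - j + 1) powi k) * of_int (S1 (n - l) m) * x ^ j" for l m j
  have summand: "fact n * (fps_exp (- 1) $ l
        * (((Lif k * fps_exp (- x)) oo fps_ln 1) oo (fps_const (1 / a) * fps_X)) $ (n - l))
      = a powi (- int n) * (\<Sum>m=0..n-l. \<Sum>j=0..m. T l m j)" if "l \<le> n" for l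
  proof -
    \<comment> \<open>Replacing t by t/a scales coefficient n-l by this power.\<close>
    have "a powi (- int n) * a ^ l = (1 / a) ^ (n - l)"
      using that assms by (simp add: power_int_minus power_diff field_simps)
    then have scale: "(1 / a) ^ (n - l) * of_nat (n choose l) * z
        = a powi (- int n) * (of_nat (n choose l) * a ^ l * z)" for z
      by (metis (no_types) mult.assoc mult.commute)
    \<comment> \<open>Here n!, the 1/l! of the exponential and the 1/(n-l)! of the Stirling formula
      combine into \<open>n choose l\<close>.\<close>
    have "fact n * (fps_exp (- 1) $ l
        * (((Lif k * fps_exp (- x)) oo fps_ln 1) oo (fps_const (1 / a) * fps_X)) $ (n - l))
      = (1 / a) ^ (n - l) * of_nat (n choose l) * ((- 1) ^ l *
          (\<Sum>m=0..n-l. (\<Sum>j=0..m. (- 1) ^ j * of_nat (m choose j) * x ^ j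
             / of_nat (m - j + 1) powi k) * of_int (S1 (n - l) m)))"
      using that unfolding fps_compose_linear
      by (simp add: fps_compose_fps_ln_1_nth Lif_mult_exp_nth binomial_fact
          del: of_nat_add of_nat_Suc)
    also have "\<dots> = a powi (- int n) * (\<Sum>m=0..n-l. \<Sum>j=0..m. T l m j)"
      unfolding scale T_def sum_distrib_left sum_distrib_right
      by (intro sum.cong refl) (simp add: power_add mult_ac)
    finally show ?thesis .
  qed
  have "PC n k x a = a powi (- int n) * (\<Sum>l=0..n. \<Sum>m=0..n-l. \<Sum>j=0..m. T l m j)"
    using sum.cong[OF refl summand, of "{0..n}" "\<lambda>l. l"]
    by (simp only: PC_def PC_gf_altdef fps_mult_nth[of "fps_exp (- 1)"] sum_distrib_left[symmetric]
        atLeastAtMost_iff)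
  \<comment> \<open>The region is l + m \<le> n, j \<le> m. Bounds become filters on
    \<open>{0..n}\<close> so that \<open>sum.swap_restrict\<close> applies, first to l and m, later
    to m and j.\<close>
  also have "(\<Sum>l=0..n. \<Sum>m=0..n-l. \<Sum>j=0..m. T l m j)
      = (\<Sum>l=0..n. \<Sum>m \<in> {m \<in> {0..n}. l + m \<le> n}. \<Sum>j=0..m. T l m j)"
    by (intro sum.cong refl) auto
  also have "\<dots> = (\<Sum>m=0..n. \<Sum>l \<in> {l \<in> {0..n}. l + m \<le> n}. \<Sum>j=0..m. T l m j)"
    by (rule sum.swap_restrict) simp_all
  also have "\<dots> = (\<Sum>m=0..n. \<Sum>l=0..n-m. \<Sum>j=0..m. T l m j)"
    by (intro sum.cong refl) auto
  also have "\<dots> = (\<Sum>m=0..n. \<Sum>j \<in> {j \<in> {0..n}. j \<le> m}. \<Sum>l=0..n-m. T l m j)"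
    by (subst sum.swap) (intro sum.cong refl; auto)
  also have "\<dots> = (\<Sum>j=0..n. \<Sum>m \<in> {m \<in> {0..n}. j \<le> m}. \<Sum>l=0..n-m. T l m j)"
    by (rule sum.swap_restrict) simp_all
  also have "\<dots> = (\<Sum>j=0..n. \<Sum>m=j..n. \<Sum>l=0..n-m. T l m j)"
    by (intro sum.cong refl) auto
  finally show ?thesis
    by (simp add: T_def sum_distrib_right)
qed

end
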